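(* If $G\in\mathbb{Np}^\infty$ is a Conway game, then $G$ is invertible and its inverse is its conjugate: $G+\overline{G}=0$.
   Context: Affine normal play forms $\mathbb{Np}^\infty$ are defined recursively: two atomic forms $\infty$ and $\overline{\infty}$ with no options; every other form is $G=\{G^{\mathcal L}\mid G^{\mathcal R}\}$ with finite nonempty sets of previously constructed forms as Left and Right options. Followers of $G$: $G$ and followers of its options. Disjunctive sum: $\infty+X=X+\infty=\infty$ for $X\neq\overline{\infty}$; $\overline{\infty}+X=X+\overline{\infty}=\overline{\infty}$ for $X\ne\infty$; $\infty+\overline{\infty}$ undefined; otherwise $G+H=\{G^L+H,G+H^L\mid G^R+H,G+H^R\}$. Outcomes: Left wins $\infty$ and Right wins $\overline{\infty}$ whoever moves; otherwise play alternates, Left moving first wins iff some Left option is won by Left moving second, Left moving second wins iff every Right option is won by Left moving first, symmetrically for Right. $o(G)\in\{\mathscr L,\mathscr N,\mathscr P,\mathscr R\}$ (Left wins either way, first player wins, second player wins, Right wins either way), ordered $\mathscr L>\mathscr N,\mathscr P>\mathscr R$ with $\mathscr N,\mathscr P$ incomparable. $G\succcurlyeq H$ means $o(G+X)\geqslant o(H+X)$ for all $X\in\mathbb{Np}^\infty\setminus\{\infty,\overline\infty\}$; $G=H$ means both $G\succcurlyeq H$ and $H\succcurlyeq G$. $0=\{\overline\infty\mid\infty\}$. $G$ is invertible if there exists $H\in\mathbb{Np}^\infty$ with $G+H=0$. Conjugate $\overline G$: $\overline\infty$ if $G=\infty$, $\infty$ if $G=\overline\infty$, otherwise $\{\overline{G^R}\mid\overline{G^L}\}$.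 A form $G\notin\{\infty,\overline\infty\}$ is a check if $\infty\in G^{\mathcal L}$ or $\overline\infty\in G^{\mathcal R}$. A Conway form is a form $G\notin\{\infty,\overline\infty\}$ none of whose followers is a check; a Conway game is a form equal to some Conway form. *)

theory Defs
  imports Main "HOL-Library.FSet"
begin

datatype form = PosInf | NegInf | Form (left: "form fset") (right: "form fset")
  where
    "left PosInf = {||}"
  | "right PosInf = {||}"
  | "left NegInf = {||}"
  | "right NegInf = {||}"

text \<open>
  The type \<open>form\<close> also contains terms with an empty set of options. The affine normal play
  forms are the members of \<open>Np\<close>.
\<close>

inductive_set Np :: "form set" where
  Np_PosInf: "PosInf \<in> Np"
| Np_NegInf: "NegInf \<in> Np"
| Np_Form: "\<lbrakk>L \<noteq> {||}; R \<noteq> {||}; \<And>K. K |\<in>| L \<Longrightarrow> K \<in> Np; \<And>K. K |\<in>| R \<Longrightarrow> K \<in> Np\<rbrakk>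
    \<Longrightarrow> Form L R \<in> Np"

inductive follower :: "form \<Rightarrow> form \<Rightarrow> bool" where
  follower_self: "follower G G"
| follower_option: "\<lbrakk>H |\<in>| left G |\<union>| right G; follower K H\<rbrakk> \<Longrightarrow> follower K G"

lemma size_less_sum_option [termination_simp]:
  assumes "(K :: form) |\<in>| S"
  shows "size K < Suc (n + (\<Sum>x\<in>fset S. Suc (size x)))"
    and "size K < Suc ((\<Sum>x\<in>fset S. Suc (size x)) + n)"
proof -
  have "Suc (size K) \<le> (\<Sum>x\<in>fset S. Suc (size x))"
    using assms by (intro member_le_sum) auto
  then show "size K < Suc (n + (\<Sum>x\<in>fset S. Suc (size x)))"
    and "size K < Suc ((\<Sum>x\<in>fset S. Suc (size x)) + n)"
    by linarith+
qed

text \<open>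
  The disjunctive sum of the two infinities is not defined. The HOL function below is total, with
  an unspecified value in these two cases, so a claim about the sum of arbitrary forms has to be
  accompanied by \<open>sum_defined\<close>. The recursion never reaches the undefined cases from a sum that
  is defined, since in every recursive call at least one summand is not atomic.
\<close>

definition sum_defined :: "form \<Rightarrow> form \<Rightarrow> bool" where
  "sum_defined G H \<longleftrightarrow> \<not> (G = PosInf \<and> H = NegInf) \<and> \<not> (G = NegInf \<and> H = PosInf)"

fun gsum :: "form \<Rightarrow> form \<Rightarrow> form" (infixl \<open>\<oplus>\<close> 65) where
  "PosInf \<oplus> NegInf = undefined"
| "NegInf \<oplus> PosInf = undefined"
| "PosInf \<oplus> X = PosInf"
| "X \<oplus> PosInf = PosInf"
| "NegInf \<oplus> X = NegInf"
| "X \<oplus> NegInf = NegInf"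
| "Form GL GR \<oplus> Form HL HR =
     Form ((\<lambda>K. K \<oplus> Form HL HR) |`| GL |\<union>| (\<lambda>K. Form GL GR \<oplus> K) |`| HL)
          ((\<lambda>K. K \<oplus> Form HL HR) |`| GR |\<union>| (\<lambda>K. Form GL GR \<oplus> K) |`| HR)"

fun conjugate :: "form \<Rightarrow> form" where
  "conjugate PosInf = NegInf"
| "conjugate NegInf = PosInf"
| "conjugate (Form L R) = Form (conjugate |`| R) (conjugate |`| L)"

definition gzero :: form where
  "gzero = Form {|NegInf|} {|PosInf|}"

fun left_wins_first left_wins_second :: "form \<Rightarrow> bool" where
  "left_wins_first PosInf \<longleftrightarrow> True"
| "left_wins_first NegInf \<longleftrightarrow> False"
| "left_wins_first (Form L R) \<longleftrightarrow> (\<exists>K|\<in>|L. left_wins_second K)"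
| "left_wins_second PosInf \<longleftrightarrow> True"
| "left_wins_second NegInf \<longleftrightarrow> False"
| "left_wins_second (Form L R) \<longleftrightarrow> (\<forall>K|\<in>|R. left_wins_first K)"

fun right_wins_first right_wins_second :: "form \<Rightarrow> bool" where
  "right_wins_first PosInf \<longleftrightarrow> False"
| "right_wins_first NegInf \<longleftrightarrow> True"
| "right_wins_first (Form L R) \<longleftrightarrow> (\<exists>K|\<in>|R. right_wins_second K)"
| "right_wins_second PosInf \<longleftrightarrow> False"
| "right_wins_second NegInf \<longleftrightarrow> True"
| "right_wins_second (Form L R) \<longleftrightarrow> (\<forall>K|\<in>|L. right_wins_first K)"

lemma determinacy:
  "right_wins_first G \<longleftrightarrow> \<not> left_wins_second G"
  "right_wins_second G \<longleftrightarrow> \<not> left_wins_first G"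
  by (induction G) auto

datatype outcome = Left_wins | Next_wins | Previous_wins | Right_wins

instantiation outcome :: order
begin

definition less_eq_outcome :: "outcome \<Rightarrow> outcome \<Rightarrow> bool" where
  "x \<le> y \<longleftrightarrow> x = y \<or> x = Right_wins \<or> y = Left_wins"

definition less_outcome :: "outcome \<Rightarrow> outcome \<Rightarrow> bool" where
  "(x :: outcome) < y \<longleftrightarrow> x \<le> y \<and> x \<noteq> y"

instance
  by standard (auto simp: less_eq_outcome_def less_outcome_def)

end

text \<open>By \<open>determinacy\<close>, the last case is the one where Right wins whoever moves first.\<close>

definition outcome :: "form \<Rightarrow> outcome" where
  "outcome G =
     (if left_wins_first G \<and> left_wins_second G then Left_wins
      else if left_wins_first G \<and> right_wins_first G then Next_wins
      else if left_wins_second G \<and> right_wins_second G then Previous_wins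
      else Right_wins)"

definition game_ge :: "form \<Rightarrow> form \<Rightarrow> bool" (infix \<open>\<succeq>\<close> 50) where
  "G \<succeq> H \<longleftrightarrow> (\<forall>X \<in> Np - {PosInf, NegInf}. outcome (G \<oplus> X) \<ge> outcome (H \<oplus> X))"

definition game_eq :: "form \<Rightarrow> form \<Rightarrow> bool" (infix \<open>\<approx>\<close> 50) where
  "G \<approx> H \<longleftrightarrow> G \<succeq> H \<and> H \<succeq> G"

definition is_inverse :: "form \<Rightarrow> form \<Rightarrow> bool" where
  "is_inverse G H \<longleftrightarrow> H \<in> Np \<and> sum_defined G H \<and> G \<oplus> H \<approx> gzero"

definition invertible :: "form \<Rightarrow> bool" where
  "invertible G \<longleftrightarrow> (\<exists>H. is_inverse G H)"

definition is_check :: "form \<Rightarrow> bool" where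
  "is_check G \<longleftrightarrow> G \<notin> {PosInf, NegInf} \<and> (PosInf |\<in>| left G \<or> NegInf |\<in>| right G)"

definition conway_form :: "form \<Rightarrow> bool" where
  "conway_form G \<longleftrightarrow>
     G \<in> Np \<and> G \<notin> {PosInf, NegInf} \<and> (\<forall>H. follower H G \<longrightarrow> \<not> is_check H)"

definition conway_game :: "form \<Rightarrow> bool" where
  "conway_game G \<longleftrightarrow> G \<in> Np \<and> (\<exists>H. conway_form H \<and> G \<approx> H)"

end

theory Submission
  imports Defs
begin

text \<open>
  If \<open>H\<close> is a Conway form, a player who wins \<open>X\<close> also wins \<open>H + conjugate H + X\<close>: she follows
  her strategy in \<open>X\<close> and answers each move in one of \<open>H\<close>, \<open>conjugate H\<close> by its mirror image in
  the other one. The answer is always available because a move of the opponent in these two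
  components never reaches an infinity that wins for him. Hence \<open>H + conjugate H = 0\<close>, and the
  general case follows since equality is a congruence for sum and conjugation.
\<close>

text \<open>Only the two atoms themselves are excluded; options of such a form may well be
  infinite.\<close>

abbreviation finite_form :: "form \<Rightarrow> bool" where
  "finite_form G \<equiv> G \<notin> {PosInf, NegInf}"

lemma finite_formE:
  assumes "finite_form G"
  obtains L R where "G = Form L R"
  using assms by (cases G) auto

lemma size_option:
  assumes "K |\<in>| L"
  shows "size K < size (Form L R)" and "size K < size (Form R L)"
  using size_less_sum_option[OF assms] by simp_all


section \<open>Sums and conjugates\<close>

lemma finite_form_gsum:
  assumes "finite_form G" "finite_form H"
  shows "finite_form (G \<oplus> H)"
  using assms by (cases G; cases H; simp)

lemma left_gsumI:
  "G' |\<in>| left G \<Longrightarrow> finite_form H \<Longrightarrow> G' \<oplus> H |\<in>| left (G \<oplus> H)"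
  "H' |\<in>| left H \<Longrightarrow> finite_form G \<Longrightarrow> G \<oplus> H' |\<in>| left (G \<oplus> H)"
  by (cases G; cases H; simp)+

lemma gsum_commute: "sum_defined G H \<Longrightarrow> G \<oplus> H = H \<oplus> G"
proof (induction G H rule: gsum.induct)
  case (7 GL GR HL HR)
  have "(\<lambda>K. K \<oplus> Form HL HR) |`| GL = (\<lambda>K. Form HL HR \<oplus> K) |`| GL"
    by (intro fset.map_cong refl 7(1)) (simp_all add: sum_defined_def)
  moreover have "(\<lambda>K. Form GL GR \<oplus> K) |`| HL = (\<lambda>K. K \<oplus> Form GL GR) |`| HL"
    by (intro fset.map_cong refl 7(2)) (simp_all add: sum_defined_def)
  moreover have "(\<lambda>K. K \<oplus> Form HL HR) |`| GR = (\<lambda>K. Form HL HR \<oplus> K) |`| GR"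
    by (intro fset.map_cong refl 7(3)) (simp_all add: sum_defined_def)
  moreover have "(\<lambda>K. Form GL GR \<oplus> K) |`| HR = (\<lambda>K. K \<oplus> Form GL GR) |`| HR"
    by (intro fset.map_cong refl 7(4)) (simp_all add: sum_defined_def)
  ultimately show ?case
    by (simp add: funion_commute)
qed (auto simp: sum_defined_def)

text \<open>With at most one infinity among the summands, every sum that occurs is defined and the
  infinity absorbs the rest. Passing to an option of one of three finite summands leaves the other
  two finite, so the induction hypothesis applies.\<close>

lemma gsum_assoc:
  assumes "finite_form G \<and> finite_form H \<or> finite_form G \<and> finite_form K \<or> finite_form H \<and> finite_form K"
  shows "(G \<oplus> H) \<oplus> K = G \<oplus> (H \<oplus> K)"
  using assms
proof (induction "size G + size H + size K" arbitrary: G H K rule: less_induct)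
  case less
  show ?case
  proof (cases "finite_form G \<and> finite_form H \<and> finite_form K")
    case False
    with less.prems show ?thesis
      by (cases G; cases H; cases K) simp_all
  next
    case True
    then obtain GL GR HL HR KL KR
      where forms: "G = Form GL GR" "H = Form HL HR" "K = Form KL KR"
      by (cases G; cases H; cases K) auto
    have G: "(G' \<oplus> H) \<oplus> K = G' \<oplus> (H \<oplus> K)" if "G' |\<in>| GL |\<union>| GR" for G'
      using that True by (intro less.hyps) (auto simp: forms dest: size_option simp del: form.size)
    have H: "(G \<oplus> H') \<oplus> K = G \<oplus> (H' \<oplus> K)" if "H' |\<in>| HL |\<union>| HR" for H'
      using that True by (intro less.hyps) (auto simp: forms dest: size_option simp del: form.size)
    have K: "(G \<oplus> H) \<oplus> K' = G \<oplus> (H \<oplus> K')" if "K' |\<in>| KL |\<union>| KR" for K'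
      using that True by (intro less.hyps) (auto simp: forms dest: size_option simp del: form.size)
    have "(\<lambda>G'. (G' \<oplus> H) \<oplus> K) |`| S = (\<lambda>G'. G' \<oplus> (H \<oplus> K)) |`| S" if "S |\<subseteq>| GL |\<union>| GR" for S
      using that G by (intro fset.map_cong) auto
    moreover have "(\<lambda>H'. (G \<oplus> H') \<oplus> K) |`| S = (\<lambda>H'. G \<oplus> (H' \<oplus> K)) |`| S" if "S |\<subseteq>| HL |\<union>| HR" for S
      using that H by (intro fset.map_cong) auto
    moreover have "(\<lambda>K'. (G \<oplus> H) \<oplus> K') |`| S = (\<lambda>K'. G \<oplus> (H \<oplus> K')) |`| S" if "S |\<subseteq>| KL |\<union>| KR" for S
      using that K by (intro fset.map_cong) auto
    ultimately show ?thesis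
      by (simp add: forms fimage_funion fset.map_comp comp_def funion_assoc)
  qed
qed

lemma conjugate_conjugate [simp]: "conjugate (conjugate G) = G"
  by (induction G) (auto simp: fset.map_comp comp_def cong: fset.map_cong)

lemma conjugate_eq_infinity_iff [simp]:
  "conjugate G = PosInf \<longleftrightarrow> G = NegInf"
  "conjugate G = NegInf \<longleftrightarrow> G = PosInf"
  by (cases G; simp)+

lemma sum_defined_finite: "finite_form G \<Longrightarrow> sum_defined G H" "finite_form H \<Longrightarrow> sum_defined G H"
  by (auto simp: sum_defined_def)

lemma conjugate_gsum: "sum_defined G H \<Longrightarrow> conjugate (G \<oplus> H) = conjugate G \<oplus> conjugate H"
proof (induction G H rule: gsum.induct)
  case (7 GL GR HL HR)
  then show ?case
    by (simp add: sum_defined_def fimage_funion fset.map_comp comp_def cong: fset.map_cong)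
qed (auto simp: sum_defined_def)

lemma Np_conjugate: "G \<in> Np \<Longrightarrow> conjugate G \<in> Np"
  by (induction rule: Np.induct) (auto intro!: Np.intros)

lemma Np_gsum:
  assumes "G \<in> Np" "H \<in> Np" "sum_defined G H"
  shows "G \<oplus> H \<in> Np"
  using assms
proof (induction G H rule: gsum.induct)
  case (7 GL GR HL HR)
  from \<open>Form GL GR \<in> Np\<close> have G: "GL \<noteq> {||}" "GR \<noteq> {||}" "\<And>K. K |\<in>| GL |\<union>| GR \<Longrightarrow> K \<in> Np"
    by (auto elim: Np.cases)
  from \<open>Form HL HR \<in> Np\<close> have H: "\<And>K. K |\<in>| HL |\<union>| HR \<Longrightarrow> K \<in> Np"
    by (auto elim: Np.cases)
  from 7 G H show ?case
    by (auto simp: sum_defined_def intro!: Np_Form)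
qed (auto simp: sum_defined_def intro: Np.intros)


section \<open>Outcomes and equality\<close>

text \<open>Conjugation exchanges the players, and by \<open>determinacy\<close> a win for Right is
  the failure of a win for Left. The arguments below can therefore speak of Left's wins
  only.\<close>

lemma left_wins_conjugate:
  "left_wins_first (conjugate G) \<longleftrightarrow> \<not> left_wins_second G"
  "left_wins_second (conjugate G) \<longleftrightarrow> \<not> left_wins_first G"
  by (induction G) auto

text \<open>By \<open>determinacy\<close> Left's two wins determine the outcome;
  \<open>Next_wins\<close> and \<open>Previous_wins\<close> are incomparable because each grants her
  exactly one of them.\<close>

lemma outcome_le_iff:
  "outcome G \<le> outcome H \<longleftrightarrow>
    (left_wins_first G \<longrightarrow> left_wins_first H) \<and> (left_wins_second G \<longrightarrow> left_wins_second H)"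
  by (auto simp: outcome_def less_eq_outcome_def determinacy)

lemma game_eq_iff:
  "G \<approx> H \<longleftrightarrow> (\<forall>X \<in> Np. finite_form X \<longrightarrow>
    (left_wins_first (G \<oplus> X) \<longleftrightarrow> left_wins_first (H \<oplus> X)) \<and>
    (left_wins_second (G \<oplus> X) \<longleftrightarrow> left_wins_second (H \<oplus> X)))"
  unfolding game_eq_def game_ge_def outcome_le_iff by blast

lemma game_eq_trans [trans]: "G \<approx> H \<Longrightarrow> H \<approx> K \<Longrightarrow> G \<approx> K"
  by (simp add: game_eq_iff)

lemma game_eq_finite_form:
  assumes "G \<approx> H" "finite_form H"
  shows "finite_form G"
proof
  \<comment> \<open>These contexts detect infinities: Left moving first wins
    \<open>H \<oplus> ?P\<close> at once but loses \<open>NegInf \<oplus> ?P\<close>; Right moving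
    first wins \<open>H \<oplus> ?N\<close> at once but loses
    \<open>PosInf \<oplus> ?N\<close>.\<close>
  let ?P = "Form {|PosInf|} {|PosInf|}" and ?N = "Form {|NegInf|} {|NegInf|}"
  have X: "?P \<in> Np" "?N \<in> Np"
    by (auto intro!: Np.intros)
  obtain L R where H: "H = Form L R"
    using assms(2) by (rule finite_formE)
  assume "G \<in> {PosInf, NegInf}"
  then show False
    using assms(1) X unfolding game_eq_iff H by force
qed

lemma game_eq_conjugate:
  assumes "G \<approx> H"
  shows "conjugate G \<approx> conjugate H"
  unfolding game_eq_iff
proof (intro ballI impI)
  fix X assume X: "X \<in> Np" "finite_form X"
  have "sum_defined K (conjugate X)" for K
    using X(2) by (intro sum_defined_finite(2)) simp
  \<comment> \<open>The conjugate is shifted from the game to the context, so the assumption can be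
    used at \<open>conjugate X\<close>.\<close>
  then have "conjugate K \<oplus> X = conjugate (K \<oplus> conjugate X)" for K
    by (simp add: conjugate_gsum)
  then show "(left_wins_first (conjugate G \<oplus> X) \<longleftrightarrow> left_wins_first (conjugate H \<oplus> X)) \<and>
    (left_wins_second (conjugate G \<oplus> X) \<longleftrightarrow> left_wins_second (conjugate H \<oplus> X))"
    using assms X(2) Np_conjugate[OF X(1)] unfolding game_eq_iff by (simp add: left_wins_conjugate)
qed

text \<open>Associativity moves \<open>K\<close> into the context, and finiteness of
  \<open>K\<close> makes \<open>K \<oplus> X\<close> an admissible context again.\<close>

lemma game_eq_gsum:
  assumes "G \<approx> H" "K \<in> Np" "finite_form K"
  shows "G \<oplus> K \<approx> H \<oplus> K"
  unfolding game_eq_iff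
proof (intro ballI impI)
  fix X assume X: "X \<in> Np" "finite_form X"
  have "K \<oplus> X \<in> Np"
    using assms(2) X(1) sum_defined_finite(1)[OF assms(3)] by (rule Np_gsum)
  moreover have "finite_form (K \<oplus> X)"
    using assms(3) X(2) by (rule finite_form_gsum)
  moreover have "(M \<oplus> K) \<oplus> X = M \<oplus> (K \<oplus> X)" for M
    using assms(3) X by (intro gsum_assoc) blast
  ultimately show "(left_wins_first (G \<oplus> K \<oplus> X) \<longleftrightarrow> left_wins_first (H \<oplus> K \<oplus> X)) \<and>
    (left_wins_second (G \<oplus> K \<oplus> X) \<longleftrightarrow> left_wins_second (H \<oplus> K \<oplus> X))"
    using assms(1) unfolding game_eq_iff by simp
qed

text \<open>A move in \<open>gzero\<close> hands the opponent the win if \<open>X\<close> is finite,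
  and an infinite \<open>X\<close> absorbs \<open>gzero\<close>.\<close>

lemma left_wins_gzero_gsum:
  "left_wins_first (gzero \<oplus> X) \<longleftrightarrow> left_wins_first X"
  "left_wins_second (gzero \<oplus> X) \<longleftrightarrow> left_wins_second X"
  by (induction X) (auto simp: gzero_def)

lemma left_wins_first_gsumI:
  "K |\<in>| left G \<Longrightarrow> left_wins_second (K \<oplus> Form L R) \<Longrightarrow> left_wins_first (G \<oplus> Form L R)"
  by (cases G) auto


section \<open>The mirror strategy\<close>

text \<open>A move in \<open>X\<close> keeps \<open>H\<close>, and a mirrored pair of moves keeps
  \<open>X\<close> and replaces \<open>H\<close> by an option, so \<open>size H + size X\<close>
  decreases. Infinite \<open>X\<close> is included because play in \<open>X\<close> can end
  there.\<close>

lemma left_wins_gsum_conjugate: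
  assumes "\<And>K. follower K H \<Longrightarrow> \<not> is_check K" "finite_form H"
  shows "(left_wins_first X \<longrightarrow> left_wins_first (H \<oplus> conjugate H \<oplus> X)) \<and>
    (left_wins_second X \<longrightarrow> left_wins_second (H \<oplus> conjugate H \<oplus> X))"
  using assms
proof (induction "size H + size X" arbitrary: H X rule: less_induct)
  case less
  obtain L R where H: "H = Form L R"
    using less.prems(2) by (rule finite_formE)
  have "\<not> is_check H"
    using less.prems(1) follower_self by blast
  then have no_check: "PosInf |\<notin>| L" "NegInf |\<notin>| R"
    by (auto simp: is_check_def H)
  define S where "S = H \<oplus> conjugate H"
  obtain SL SR where S: "S = Form SL SR"
    by (simp add: S_def H)
  \<comment> \<open>Right's options of \<open>conjugate H\<close> are conjugates of elements of
    \<open>L\<close>, so by \<open>no_check\<close> no move of Right inside \<open>S\<close> turns a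
    component into \<open>NegInf\<close>.\<close>
  have SR: "SR = (\<lambda>K. K \<oplus> conjugate H) |`| R |\<union>| (\<lambda>K. H \<oplus> conjugate K) |`| L"
    using S by (simp add: S_def H fset.map_comp comp_def)
  show ?case
  proof (cases X)
    case PosInf
    then show ?thesis
      using S unfolding S_def by simp
  next
    case NegInf
    then show ?thesis
      by simp
  next
    case (Form XL XR)
    have IH_X: "(left_wins_first X' \<longrightarrow> left_wins_first (S \<oplus> X')) \<and>
        (left_wins_second X' \<longrightarrow> left_wins_second (S \<oplus> X'))" if "X' |\<in>| XL |\<union>| XR" for X'
      unfolding S_def using that less.prems
      by (intro less.hyps) (auto simp: Form dest: size_option simp del: form.size)
    have IH_H: "left_wins_second (K \<oplus> conjugate K \<oplus> X)"
      if "K |\<in>| L |\<union>| R" "finite_form K" "left_wins_second X" for K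
    proof -
      have "follower M H" if "follower M K" for M
        using that \<open>K |\<in>| L |\<union>| R\<close> by (auto simp: H intro: follower_option)
      moreover have "size K < size H"
        using \<open>K |\<in>| L |\<union>| R\<close> by (auto simp: H dest: size_option simp del: form.size)
      ultimately show ?thesis
        using that less.prems(1) less.hyps[of K X] by auto
    qed
    \<comment> \<open>Right has just moved inside \<open>S\<close>, reaching \<open>T\<close>, and
      Left has to answer.\<close>
    have mirror: "left_wins_first (T \<oplus> X)" if "T |\<in>| SR" "left_wins_second X" for T
    proof -
      consider K where "K |\<in>| R" "T = K \<oplus> conjugate H" | K where "K |\<in>| L" "T = H \<oplus> conjugate K"
        using \<open>T |\<in>| SR\<close> by (auto simp: SR)
      then show ?thesis
      proof cases
        case 1
        show ?thesis
        proof (cases K)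
          \<comment> \<open>Right moved to an infinity that wins for Left and absorbs the other
            summands.\<close>
          case PosInf
          then show ?thesis
            by (simp add: 1 H Form)
        next
          case NegInf
          then show ?thesis
            using 1 no_check by simp
        next
          case K: (Form KL KR)
          then have fin: "finite_form K"
            by simp
          have "left_wins_second (K \<oplus> conjugate K \<oplus> X)"
            using 1(1) fin that by (intro IH_H) auto
          \<comment> \<open>Right moved in \<open>H\<close>; the answer \<open>conjugate K\<close>
            is a Left option of \<open>conjugate H\<close> because \<open>K\<close> is in
            \<open>R\<close>.\<close>
          moreover have "K \<oplus> conjugate K |\<in>| left T"
            unfolding 1(2) using 1(1) fin by (intro left_gsumI(2)) (simp_all add: H)
          ultimately show ?thesis
            using left_wins_first_gsumI Form by blast
        qed
      next
        case 2
        show ?thesis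
        proof (cases K)
          case NegInf
          then show ?thesis
            by (simp add: 2 H Form)
        next
          case PosInf
          then show ?thesis
            using 2 no_check by simp
        next
          case K: (Form KL KR)
          then have fin: "finite_form K"
            by simp
          have "left_wins_second (K \<oplus> conjugate K \<oplus> X)"
            using 2(1) fin that by (intro IH_H) auto
          \<comment> \<open>Right moved in \<open>conjugate H\<close>; Left answers by moving from
            \<open>H\<close> to \<open>K\<close>.\<close>
          moreover have "K \<oplus> conjugate K |\<in>| left T"
            unfolding 2(2) using 2(1) fin by (intro left_gsumI(1)) (simp_all add: H)
          ultimately show ?thesis
            using left_wins_first_gsumI Form by blast
        qed
      qed
    qed
    have "left_wins_first (S \<oplus> X)" if "left_wins_first X"
      using that IH_X by (auto simp: S Form)
    moreover have "left_wins_second (S \<oplus> X)" if "left_wins_second X"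
      using that IH_X mirror by (auto simp: S Form)
    ultimately show ?thesis
      unfolding S_def by blast
  qed
qed

lemma conway_form_gsum_conjugate:
  assumes "conway_form H"
  shows "H \<oplus> conjugate H \<approx> gzero"
proof -
  have H: "\<And>K. follower K H \<Longrightarrow> \<not> is_check K" "finite_form H"
    using assms by (auto simp: conway_form_def)
  define S where "S = H \<oplus> conjugate H"
  have "sum_defined H (conjugate H)"
    using H(2) by (rule sum_defined_finite)
  \<comment> \<open>Conjugation merely swaps the two summands of \<open>S\<close>.\<close>
  then have conj: "conjugate S = S"
    unfolding S_def by (metis conjugate_gsum conjugate_conjugate gsum_commute)
  have "finite_form S"
    unfolding S_def using H(2) by (intro finite_form_gsum) auto
  then have "conjugate (S \<oplus> X) = S \<oplus> conjugate X" for X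
    using conj by (simp add: conjugate_gsum sum_defined_finite del: insert_iff)
  moreover have win: "left_wins_first X \<Longrightarrow> left_wins_first (S \<oplus> X)"
    "left_wins_second X \<Longrightarrow> left_wins_second (S \<oplus> X)" for X
    using left_wins_gsum_conjugate[OF H] unfolding S_def by blast+
  \<comment> \<open>For the converse, if Left does not win \<open>X\<close>, she wins
    \<open>conjugate X\<close> with the turn order reversed, hence by \<open>win\<close> also
    \<open>S \<oplus> conjugate X\<close>. This is the conjugate of \<open>S \<oplus> X\<close>,
    which she therefore does not win.\<close>
  ultimately have "left_wins_first (S \<oplus> X) \<longleftrightarrow> left_wins_first X"
    "left_wins_second (S \<oplus> X) \<longleftrightarrow> left_wins_second X" for X
    by (metis left_wins_conjugate)+
  then show ?thesis
    unfolding game_eq_iff S_def by (simp add: left_wins_gzero_gsum)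
qed

theorem theorem2p11:
  fixes G :: form
  assumes "G \<in> Np" and "conway_game G"
  shows "invertible G \<and> is_inverse G (conjugate G)"
proof -
  obtain H where H: "conway_form H" "G \<approx> H"
    using assms(2) by (auto simp: conway_game_def)
  have Np: "H \<in> Np" "conjugate G \<in> Np" and fin_H: "finite_form H"
    using H(1) assms(1) by (auto simp: conway_form_def Np_conjugate)
  have fin_G: "finite_form G"
    using H(2) fin_H by (rule game_eq_finite_form)
  \<comment> \<open>\<open>game_eq_gsum\<close> replaces a left summand, so the two summands are
    replaced one after the other, with a commutation in between.\<close>
  have "G \<oplus> conjugate G \<approx> H \<oplus> conjugate G"
    using H(2) Np(2) fin_G by (intro game_eq_gsum) auto
  also have "H \<oplus> conjugate G = conjugate G \<oplus> H"
    using fin_H by (intro gsum_commute sum_defined_finite)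
  also have "conjugate G \<oplus> H \<approx> conjugate H \<oplus> H"
    using game_eq_conjugate[OF H(2)] Np(1) fin_H by (rule game_eq_gsum)
  also have "conjugate H \<oplus> H = H \<oplus> conjugate H"
    using fin_H by (intro gsum_commute sum_defined_finite)
  also have "H \<oplus> conjugate H \<approx> gzero"
    using H(1) by (rule conway_form_gsum_conjugate)
  finally have "is_inverse G (conjugate G)"
    using Np(2) fin_G sum_defined_finite(1) unfolding is_inverse_def by blast
  then show ?thesis
    unfolding invertible_def by blast
qed

end
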